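(* Let $I\subseteq\mathbb R$ be a nondegenerate interval. For $f\in\mathcal A_D(I)$ and $a,b\in I$ let $\int_a^b f=F(b)-F(a)$ denote the $LD$ primitive integral, where $F$ is a primitive of $f$ in $\mathcal D^{lc}(I)$. Then: (a) The $LD$ primitive integral is unique, i.e. the value $F(b)-F(a)$ does not depend on the choice of the primitive $F\in\mathcal D^{lc}(I)$ of $f$. (b) (Additivity over intervals.) If $f\in\mathcal A_D(I)$, then for all $a\le c\le b$ in $I$ we have $\int_a^c f+\int_c^b f=\int_a^b f$. (c) (Linearity.) If $f_1,f_2\in\mathcal A_D(I)$ and $a_1,a_2\in\mathbb R$, then $a_1f_1+a_2f_2\in\mathcal A_D(I)$ and $\int_a^b(a_1f_1+a_2f_2)=a_1\int_a^b f_1+a_2\int_a^b f_2$ for all $a,b\in I$. (d) (Reversing limits of integration.) If $f\in\mathcal A_D(I)$ and $a,b\in I$, then $\int_b^a f=-\int_a^b f$.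
   Context: Distributions: $\mathcal D$ is the space of test functions on $I$, i.e. infinitely differentiable functions $\varphi:\mathbb R\to\mathbb R$ whose support is a compact subset of $I$; $\varphi_n\to\varphi$ in $\mathcal D$ means that there is a compact $K\subseteq I$ containing all supports of the $\varphi_n$ and that $\varphi_n^{(m)}\to\varphi^{(m)}$ uniformly on $K$ for every $m\ge 0$. $\mathcal D'$ is the space of (sequentially) continuous linear functionals on $\mathcal D$ (distributions on $I$), and the distributional derivative is $\langle T',\varphi\rangle=-\langle T,\varphi'\rangle$. A function $H:I\to\mathbb R$ is left regulated if it has a finite left limit at each point of $I$ except the possible minimum of $I$. "Locally Henstock--Kurzweil ($HK$) integrable" means $HK$ integrable on each compact subinterval of $I$. $H(\inf I+)$ is the limit of $H(t)$ as $t\to\inf I$ from the right (as $t\to-\infty$ if $\inf I=-\infty$), required to be finite. Define: - $\mathcal D^{lr}(I)$: all $H:I\to\mathbb R$ that are left regulated, locally $HK$ integrable, and have a right limit at $\inf I$; - $\mathcal D^{lc}(I)$: all $G\in\mathcal D^{lr}(I)$ that are left continuous at every point of $I$ other than the possible minimum, with $G(\min I)=G(\min I+)$ if $\min I$ exists. A function $H\in\mathcal D^{lr}(I)$ defines a distribution by $\langle H,\varphi\rangle=\int_a^bH(t)\varphi(t)\,dt$ ($HK$ integral, $\operatorname{supp}\varphi\subseteq[a,b]\subseteq I$). $\mathcal A_D(I)$ is the set of all $f\in\mathcal D'$ with $f=H'$ (distributional derivative) for some $H\in\mathcal D^{lr}(I)$; such an $H$ is called a primitive of $f$. Every $f\in\mathcal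 A_D(I)$ has a primitive in $\mathcal D^{lc}(I)$, obtained from $H$ by replacing $H(x)$ by $H(x-)$ for $x>\inf I$ and by $H(x+)$ for $x=\min I$ (if it exists). *)

theory Defs
  imports "HOL-Analysis.Analysis"
begin

definition func_support :: "(real \<Rightarrow> real) \<Rightarrow> real set" where
  "func_support \<phi> = closure {x. \<phi> x \<noteq> 0}"

definition infinitely_differentiable :: "(real \<Rightarrow> real) \<Rightarrow> bool" where
  "infinitely_differentiable \<phi> \<longleftrightarrow> (\<forall>m. (deriv ^^ m) \<phi> differentiable_on UNIV)"

definition test_functions :: "real set \<Rightarrow> (real \<Rightarrow> real) set" where
  "test_functions I =
     {\<phi>. infinitely_differentiable \<phi> \<and> compact (func_support \<phi>) \<and> func_support \<phi> \<subseteq> I}"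

text \<open>The compact set \<open>K\<close> is required to contain the support of the limit as well; otherwise
  \<open>K = {}\<close> would let the zero sequence converge to every test function.\<close>

definition test_converges ::
    "real set \<Rightarrow> (nat \<Rightarrow> real \<Rightarrow> real) \<Rightarrow> (real \<Rightarrow> real) \<Rightarrow> bool" where
  "test_converges I \<phi>s \<phi> \<longleftrightarrow>
     (\<exists>K. compact K \<and> K \<subseteq> I \<and> (\<forall>n. func_support (\<phi>s n) \<subseteq> K) \<and> func_support \<phi> \<subseteq> K \<and>
        (\<forall>m. uniform_limit K (\<lambda>n. (deriv ^^ m) (\<phi>s n)) ((deriv ^^ m) \<phi>) sequentially))"

text \<open>A functional on the test functions is represented by a total function that is \<open>0\<close> outside
  \<open>test_functions I\<close>, so that equality of distributions is equality of HOL functions and linear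
  combinations are pointwise.\<close>

definition distributions :: "real set \<Rightarrow> ((real \<Rightarrow> real) \<Rightarrow> real) set" where
  "distributions I =
     {T. (\<forall>\<phi>. \<phi> \<notin> test_functions I \<longrightarrow> T \<phi> = 0) \<and>
         (\<forall>\<phi>\<in>test_functions I. \<forall>\<psi>\<in>test_functions I. \<forall>c d.
            T (\<lambda>x. c * \<phi> x + d * \<psi> x) = c * T \<phi> + d * T \<psi>) \<and>
         (\<forall>\<phi>s \<phi>. (\<forall>n. \<phi>s n \<in> test_functions I) \<longrightarrow> \<phi> \<in> test_functions I \<longrightarrow>
            test_converges I \<phi>s \<phi> \<longrightarrow> (\<lambda>n. T (\<phi>s n)) \<longlonglongrightarrow> T \<phi>)}"

definition distr_deriv ::
    "real set \<Rightarrow> ((real \<Rightarrow> real) \<Rightarrow> real) \<Rightarrow> (real \<Rightarrow> real) \<Rightarrow> real" where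
  "distr_deriv I T \<phi> = (if \<phi> \<in> test_functions I then - T (deriv \<phi>) else 0)"

text \<open>Integrating over \<open>I\<close> avoids choosing a compact subinterval containing the support;
  \<open>distr_of_eq_integral\<close> shows that any such subinterval gives the same value.\<close>

definition distr_of :: "real set \<Rightarrow> (real \<Rightarrow> real) \<Rightarrow> (real \<Rightarrow> real) \<Rightarrow> real" where
  "distr_of I H \<phi> = (if \<phi> \<in> test_functions I then integral I (\<lambda>t. H t * \<phi> t) else 0)"

lemma distr_of_eq_integral:
  assumes "\<phi> \<in> test_functions I" and "func_support \<phi> \<subseteq> {a..b}" and "{a..b} \<subseteq> I"
  shows "distr_of I H \<phi> = integral {a..b} (\<lambda>t. H t * \<phi> t)"
proof -
  have "\<phi> x = 0" if "x \<notin> {a..b}" for x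
    using that assms(2) closure_subset[of "{x. \<phi> x \<noteq> 0}"] unfolding func_support_def by blast
  then have "(\<lambda>t. if t \<in> I then H t * \<phi> t else 0) = (\<lambda>t. if t \<in> {a..b} then H t * \<phi> t else 0)"
    using assms(3) by (intro ext) (simp add: subset_iff)
  then have "integral I (\<lambda>t. H t * \<phi> t) = integral {a..b} (\<lambda>t. H t * \<phi> t)"
    using integral_restrict_UNIV[of I "\<lambda>t. H t * \<phi> t"]
      integral_restrict_UNIV[of "{a..b}" "\<lambda>t. H t * \<phi> t"] by simp
  then show ?thesis
    using assms(1) by (simp add: distr_of_def)
qed

text \<open>Functions on \<open>I\<close> are represented by total functions of which only the values on \<open>I\<close> matter:
  for a nondegenerate interval all filters used below are eventually inside \<open>I\<close>.\<close>

definition is_min_of :: "real \<Rightarrow> real set \<Rightarrow> bool" where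
  "is_min_of x I \<longleftrightarrow> x \<in> I \<and> (\<forall>y\<in>I. x \<le> y)"

definition left_regulated :: "real set \<Rightarrow> (real \<Rightarrow> real) \<Rightarrow> bool" where
  "left_regulated I H \<longleftrightarrow> (\<forall>x\<in>I. \<not> is_min_of x I \<longrightarrow> (\<exists>L. (H \<longlongrightarrow> L) (at_left x)))"

definition locally_HK_integrable :: "real set \<Rightarrow> (real \<Rightarrow> real) \<Rightarrow> bool" where
  "locally_HK_integrable I H \<longleftrightarrow> (\<forall>a b. {a..b} \<subseteq> I \<longrightarrow> H integrable_on {a..b})"

definition at_inf_right :: "real set \<Rightarrow> real filter" where
  "at_inf_right I = (if bdd_below I then at_right (Inf I) else at_bot)"

definition D_lr :: "real set \<Rightarrow> (real \<Rightarrow> real) set" where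
  "D_lr I = {H. left_regulated I H \<and> locally_HK_integrable I H \<and>
                (\<exists>L. (H \<longlongrightarrow> L) (at_inf_right I))}"

definition D_lc :: "real set \<Rightarrow> (real \<Rightarrow> real) set" where
  "D_lc I = {G \<in> D_lr I.
     (\<forall>x\<in>I. \<not> is_min_of x I \<longrightarrow> (G \<longlongrightarrow> G x) (at_left x)) \<and>
     (\<forall>x. is_min_of x I \<longrightarrow> (G \<longlongrightarrow> G x) (at_right x))}"

definition primitive_of ::
    "real set \<Rightarrow> (real \<Rightarrow> real) \<Rightarrow> ((real \<Rightarrow> real) \<Rightarrow> real) \<Rightarrow> bool" where
  "primitive_of I H f \<longleftrightarrow> H \<in> D_lr I \<and> f = distr_deriv I (distr_of I H)"

definition A_D :: "real set \<Rightarrow> ((real \<Rightarrow> real) \<Rightarrow> real) set" where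
  "A_D I = {f \<in> distributions I. \<exists>H. primitive_of I H f}"

definition LD_integral ::
    "real set \<Rightarrow> real \<Rightarrow> real \<Rightarrow> ((real \<Rightarrow> real) \<Rightarrow> real) \<Rightarrow> real" where
  "LD_integral I a b f = (let F = (SOME F. F \<in> D_lc I \<and> primitive_of I F f) in F b - F a)"

end

theory Submission
  imports Defs
begin

text \<open>
  Additivity and reversal of limits are immediate, since the integral is an increment
  \<open>F b - F a\<close> of one function \<open>F\<close> chosen for \<open>f\<close>.  The content lies in two facts.

  Uniqueness of the increment.  If \<open>F\<close> and \<open>G\<close> are primitives of the same distribution, then
  \<open>h = F - G\<close> satisfies \<open>\<integral> h \<phi>' = 0\<close> for every test function \<open>\<phi>\<close>.  Choose for \<open>\<phi>\<close> the difference of two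
  smooth steps that fall from 1 to 0 just to the left of \<open>y\<close> and of \<open>x\<close>: its derivative is the
  difference of two unit bumps concentrated there.  Left continuity makes the integral close to
  \<open>h x - h y\<close>, so \<open>h x = h y\<close> away from the minimum of \<open>I\<close>
  (lemma \<open>left_continuous_eq_if_weak_derivative_zero\<close>).  If there is a minimum, right continuity
  extends the equality to it.

  Existence of a primitive in \<open>D_lc I\<close>, without which the chosen \<open>F\<close> would be arbitrary and
  linearity could fail.  Replacing a primitive \<open>H\<close> by its left limits changes it only on a countable set
  (lemma \<open>countable_left_discontinuities\<close>), so the distribution is the same, and the new function
  is left continuous (lemma \<open>primitive_in_D_lc_exists\<close>).

  Linearity also needs additivity of the integrals \<open>\<integral> H \<phi>'\<close>, that is, integrability
  of the product of a Henstock--Kurzweil integrable function and a test function; it follows from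
  the second mean value theorem (lemma \<open>integrable_mult_C1\<close>).
\<close>

section \<open>Smooth step functions\<close>

text \<open>This recursive form suits induction: closure under products and compositions follows from the
  product and chain rules at each level, with the derivative as an explicit witness.  A function is
  infinitely differentiable when it satisfies the predicate for every \<open>n\<close>.\<close>

primrec times_differentiable :: "nat \<Rightarrow> (real \<Rightarrow> real) \<Rightarrow> bool" where
  "times_differentiable 0 f \<longleftrightarrow> True"
| "times_differentiable (Suc n) f \<longleftrightarrow>
     (\<exists>f'. (\<forall>x. (f has_real_derivative f' x) (at x)) \<and> times_differentiable n f')"

lemma times_differentiable_SucD: "times_differentiable (Suc n) f \<Longrightarrow> times_differentiable n f"
proof (induction n arbitrary: f)
  case (Suc n)
  then show ?case by (metis times_differentiable.simps(2))
qed simp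

lemma times_differentiable_const: "times_differentiable n (\<lambda>_. c)"
proof (induction n arbitrary: c)
  case (Suc n)
  have "\<forall>x. ((\<lambda>_. c) has_real_derivative 0) (at x)" by simp
  with Suc show ?case
    unfolding times_differentiable.simps by (intro exI[of _ "\<lambda>_. 0"] conjI)
qed simp

lemma times_differentiable_id: "times_differentiable n (\<lambda>x. x)"
proof (cases n)
  case (Suc m)
  have "\<forall>x. ((\<lambda>x. x) has_real_derivative 1) (at x)" by simp
  then show ?thesis
    unfolding Suc times_differentiable.simps
    by (intro exI[of _ "\<lambda>_. 1"] conjI times_differentiable_const)
qed simp

lemma times_differentiable_add:
  "times_differentiable n f \<Longrightarrow> times_differentiable n g \<Longrightarrow> times_differentiable n (\<lambda>x. f x + g x)"
proof (induction n arbitrary: f g)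
  case (Suc n)
  then obtain f' g' where f': "\<forall>x. (f has_real_derivative f' x) (at x)" "times_differentiable n f'"
    and g': "\<forall>x. (g has_real_derivative g' x) (at x)" "times_differentiable n g'"
    by auto
  have "\<forall>x. ((\<lambda>x. f x + g x) has_real_derivative f' x + g' x) (at x)"
    using f'(1) g'(1) by (auto intro!: derivative_intros)
  with Suc.IH[OF f'(2) g'(2)] show ?case
    unfolding times_differentiable.simps by (intro exI[of _ "\<lambda>x. f' x + g' x"]) simp
qed simp

lemma times_differentiable_mult:
  "times_differentiable n f \<Longrightarrow> times_differentiable n g \<Longrightarrow> times_differentiable n (\<lambda>x. f x * g x)"
proof (induction n arbitrary: f g)
  case (Suc n)
  obtain f' g' where f': "\<forall>x. (f has_real_derivative f' x) (at x)" "times_differentiable n f'"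
    and g': "\<forall>x. (g has_real_derivative g' x) (at x)" "times_differentiable n g'"
    using Suc.prems by auto
  have "\<forall>x. ((\<lambda>x. f x * g x) has_real_derivative f' x * g x + f x * g' x) (at x)"
    using f'(1) g'(1) by (auto intro!: derivative_eq_intros)
  moreover have "times_differentiable n (\<lambda>x. f' x * g x + f x * g' x)"
    using times_differentiable_add[OF Suc.IH[OF f'(2) times_differentiable_SucD[OF Suc.prems(2)]]
        Suc.IH[OF times_differentiable_SucD[OF Suc.prems(1)] g'(2)]] .
  ultimately show ?case
    unfolding times_differentiable.simps by (intro exI[of _ "\<lambda>x. f' x * g x + f x * g' x"]) simp
qed simp

lemma times_differentiable_diff:
  "times_differentiable n f \<Longrightarrow> times_differentiable n g \<Longrightarrow> times_differentiable n (\<lambda>x. f x - g x)"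
  using times_differentiable_add[OF _ times_differentiable_mult[OF times_differentiable_const], of n f g "-1"]
  by simp

lemma times_differentiable_compose:
  "times_differentiable n f \<Longrightarrow> times_differentiable n g \<Longrightarrow> times_differentiable n (\<lambda>x. f (g x))"
proof (induction n arbitrary: f g)
  case (Suc n)
  obtain f' g' where f': "\<forall>x. (f has_real_derivative f' x) (at x)" "times_differentiable n f'"
    and g': "\<forall>x. (g has_real_derivative g' x) (at x)" "times_differentiable n g'"
    using Suc.prems by auto
  have "\<forall>x. ((\<lambda>x. f (g x)) has_real_derivative f' (g x) * g' x) (at x)"
    using f'(1) g'(1) by (auto intro: DERIV_chain2)
  moreover have "times_differentiable n (\<lambda>x. f' (g x) * g' x)"
    using times_differentiable_mult[OF Suc.IH[OF f'(2) times_differentiable_SucD[OF Suc.prems(2)]] g'(2)] .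
  ultimately show ?case
    unfolding times_differentiable.simps by (intro exI[of _ "\<lambda>x. f' (g x) * g' x"]) simp
qed simp

lemma infinitely_differentiableI:
  assumes "\<And>n. times_differentiable n f"
  shows "infinitely_differentiable f"
proof -
  have "(deriv ^^ m) f differentiable_on UNIV" if "times_differentiable (Suc m) f" for m and f :: "real \<Rightarrow> real"
    using that
  proof (induction m arbitrary: f)
    case 0
    then show ?case
      by (auto simp: differentiable_on_def real_differentiable_def)
  next
    case (Suc m)
    then obtain f' where f': "\<forall>x. (f has_real_derivative f' x) (at x)"
      and n: "times_differentiable (Suc m) f'"
      by (metis times_differentiable.simps(2))
    have "deriv f = f'"
      using f' by (auto intro: DERIV_imp_deriv)
    with Suc.IH[OF n] show ?case
      by (simp add: funpow_Suc_right del: funpow.simps)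
  qed
  with assms show ?thesis
    unfolding infinitely_differentiable_def by blast
qed

lemma infinitely_differentiable_deriv:
  assumes "infinitely_differentiable f"
  shows "infinitely_differentiable (deriv f)"
  unfolding infinitely_differentiable_def
proof
  fix m
  have "(deriv ^^ Suc m) f differentiable_on UNIV"
    using assms unfolding infinitely_differentiable_def by blast
  then show "(deriv ^^ m) (deriv f) differentiable_on UNIV"
    by (simp add: funpow_Suc_right del: funpow.simps)
qed

lemma infinitely_differentiable_has_deriv:
  assumes "infinitely_differentiable f"
  shows "(f has_real_derivative deriv f x) (at x)"
proof -
  have "(deriv ^^ 0) f differentiable_on UNIV"
    using assms unfolding infinitely_differentiable_def by blast
  then show ?thesis
    by (auto simp: differentiable_on_def DERIV_deriv_iff_real_differentiable)
qed

text \<open>The functions \<open>t^(-k) * exp (-1/t)\<close>, extended by \<open>0\<close> to \<open>t \<le> 0\<close>; the one needed is \<open>k = 0\<close>.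
  The others are included because the derivatives of this family are linear combinations of
  members of the family, so smoothness of all of them follows by one induction.\<close>

definition flat_exp :: "nat \<Rightarrow> real \<Rightarrow> real" where
  "flat_exp k t = (if t > 0 then inverse t ^ k * exp (- inverse t) else 0)"

lemma flat_exp_tendsto_0: "(flat_exp k \<longlongrightarrow> 0) (at_right 0)"
proof -
  have "((\<lambda>y::real. y ^ k * exp (- y)) \<longlongrightarrow> 0) at_top"
    using tendsto_power_div_exp_0[of k] by (simp add: exp_minus field_simps)
  then have "((\<lambda>t. inverse t ^ k * exp (- inverse t)) \<longlongrightarrow> 0) (at_right (0::real))"
    by (rule filterlim_compose[OF _ filterlim_inverse_at_top_right])
  moreover have "\<forall>\<^sub>F t in at_right 0. inverse t ^ k * exp (- inverse t) = flat_exp k t"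
    unfolding eventually_at_right_field by (auto simp: flat_exp_def intro: exI[of _ 1])
  ultimately show ?thesis
    by (rule Lim_transform_eventually)
qed

text \<open>At \<open>t = 0\<close> the difference quotient from the right is again a member of the family, with
  \<open>k\<close> raised by one, and exponential decay beats every power of \<open>1/t\<close>.\<close>

lemma flat_exp_has_derivative:
  "(flat_exp k has_real_derivative flat_exp (k + 2) t - real k * flat_exp (k + 1) t) (at t)"
proof -
  consider "t > 0" | "t < 0" | "t = 0" by linarith
  then show ?thesis
  proof cases
    case 1
    have "((\<lambda>t. inverse t ^ k * exp (- inverse t)) has_real_derivative
        inverse t ^ k * (exp (- inverse t) * inverse t ^ 2)
          - real k * inverse t ^ (k - 1) * inverse t ^ 2 * exp (- inverse t)) (at t)"
      using 1 by (auto intro!: derivative_eq_intros simp: power2_eq_square)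
    also have "inverse t ^ k * (exp (- inverse t) * inverse t ^ 2)
          - real k * inverse t ^ (k - 1) * inverse t ^ 2 * exp (- inverse t)
        = flat_exp (k + 2) t - real k * flat_exp (k + 1) t"
      using 1 by (cases k) (simp_all add: flat_exp_def power_add power2_eq_square)
    finally have "((\<lambda>t. inverse t ^ k * exp (- inverse t)) has_real_derivative
        flat_exp (k + 2) t - real k * flat_exp (k + 1) t) (at t)" .
    moreover have "open {0::real<..}" "t \<in> {0<..}" using 1 by auto
    ultimately show ?thesis
      by (rule has_field_derivative_transform_within_open) (simp add: flat_exp_def)
  next
    case 2
    have "((\<lambda>_. 0) has_real_derivative flat_exp (k + 2) t - real k * flat_exp (k + 1) t) (at t)"
      using 2 by (simp add: flat_exp_def)
    moreover have "open {..<0::real}" "t \<in> {..<0}" using 2 by auto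
    ultimately show ?thesis
      by (rule has_field_derivative_transform_within_open) (simp add: flat_exp_def)
  next
    case 3
    have "((\<lambda>h. flat_exp k h / h) \<longlongrightarrow> 0) (at 0)"
    proof (rule filterlim_split_at)
      have "\<forall>\<^sub>F h in at_left 0. 0 = flat_exp k h / h"
        unfolding eventually_at_left_field by (auto simp: flat_exp_def intro: exI[of _ "-1"])
      then show "((\<lambda>h. flat_exp k h / h) \<longlongrightarrow> 0) (at_left 0)"
        by (rule Lim_transform_eventually[OF tendsto_const])
      have "\<forall>\<^sub>F h in at_right 0. flat_exp (Suc k) h = flat_exp k h / h"
        unfolding eventually_at_right_field
        by (auto simp: flat_exp_def field_simps intro: exI[of _ 1])
      then show "((\<lambda>h. flat_exp k h / h) \<longlongrightarrow> 0) (at_right 0)"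
        by (rule Lim_transform_eventually[OF flat_exp_tendsto_0])
    qed
    then show ?thesis
      using 3 by (simp add: DERIV_def flat_exp_def)
  qed
qed

lemma times_differentiable_flat_exp: "times_differentiable n (flat_exp k)"
proof (induction n arbitrary: k)
  case (Suc n)
  have "times_differentiable n (\<lambda>t. flat_exp (k + 2) t - real k * flat_exp (k + 1) t)"
    by (intro times_differentiable_diff times_differentiable_mult times_differentiable_const Suc)
  then show ?case
    using flat_exp_has_derivative unfolding times_differentiable.simps
    by (intro exI[of _ "\<lambda>t. flat_exp (k + 2) t - real k * flat_exp (k + 1) t"]) blast
qed simp

lemma flat_exp_0_mono: "mono (flat_exp 0)"
proof
  fix s t :: real assume "s \<le> t"
  then show "flat_exp 0 s \<le> flat_exp 0 t"
    by (auto simp: flat_exp_def le_imp_inverse_le)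
qed

text \<open>Write \<open>f\<close> for \<open>flat_exp 0\<close>, which vanishes on \<open>t \<le> 0\<close> and increases.  Then \<open>f (f 1 - f t)\<close>
  decreases, equals the constant \<open>f (f 1)\<close> for \<open>t \<le> 0\<close> and vanishes for \<open>t \<ge> 1\<close>, where
  \<open>f t \<ge> f 1\<close>.  Normalising it and rescaling \<open>[0,1]\<close> to \<open>[a,b]\<close> gives the step.  Its derivative is
  a nonpositive bump of total mass \<open>-1\<close>, obtained without integrating a bump function.\<close>

lemma smooth_step_exists:
  fixes a b :: real
  assumes "a < b"
  obtains s where "\<And>n. times_differentiable n s" "antimono s"
    "\<And>t. t \<le> a \<Longrightarrow> s t = 1" "\<And>t. t \<ge> b \<Longrightarrow> s t = 0"
proof
  define c where "c = flat_exp 0 1"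
  define s where "s = (\<lambda>t. inverse (flat_exp 0 c) * flat_exp 0 (c - flat_exp 0 (inverse (b - a) * (t - a))))"
  have c: "c > 0" by (simp add: c_def flat_exp_def)
  then have fc: "flat_exp 0 c > 0" by (simp add: flat_exp_def)
  show "times_differentiable n s" for n
    unfolding s_def
    by (intro times_differentiable_mult times_differentiable_const times_differentiable_diff
        times_differentiable_id times_differentiable_flat_exp
        times_differentiable_compose[OF times_differentiable_flat_exp])
  show "antimono s"
  proof
    fix x y :: real assume "x \<le> y"
    then have "inverse (b - a) * (x - a) \<le> inverse (b - a) * (y - a)"
      using assms by (intro mult_left_mono) auto
    then show "s y \<le> s x"
      unfolding s_def using fc
      by (intro mult_left_mono[of "flat_exp 0 _"] monoD[OF flat_exp_0_mono] diff_left_mono) simp_all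
  qed
  show "s t = 1" if "t \<le> a" for t
  proof -
    have "inverse (b - a) * (t - a) \<le> 0"
      using that assms by (intro mult_nonneg_nonpos) auto
    then have "flat_exp 0 (inverse (b - a) * (t - a)) = 0"
      unfolding flat_exp_def by auto
    then show ?thesis using fc by (simp add: s_def)
  qed
  show "s t = 0" if "t \<ge> b" for t
  proof -
    have "1 \<le> inverse (b - a) * (t - a)"
      using that assms by (simp add: field_simps)
    then have "c \<le> flat_exp 0 (inverse (b - a) * (t - a))"
      unfolding c_def by (rule monoD[OF flat_exp_0_mono])
    then show ?thesis by (simp add: s_def flat_exp_def)
  qed
qed

section \<open>Pairing locally integrable functions with test functions\<close>

text \<open>A Henstock--Kurzweil integrable function need not be absolutely integrable, so the bounded
  factor must have bounded variation.  The second mean value theorem handles monotone factors,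
  and \<open>g\<close> is the difference of the monotone functions \<open>g x + M * x\<close> and \<open>M * x\<close> once \<open>M\<close> bounds the
  derivative.\<close>

lemma integrable_mult_C1:
  fixes f g g' :: "real \<Rightarrow> real"
  assumes f: "f integrable_on {a..b}"
    and g: "\<And>x. x \<in> {a..b} \<Longrightarrow> (g has_real_derivative g' x) (at x)"
    and g': "continuous_on {a..b} g'"
  shows "(\<lambda>x. f x * g x) integrable_on {a..b}"
proof (cases "a \<le> b")
  case True
  have "bounded (g' ` {a..b})"
    by (intro compact_imp_bounded compact_continuous_image g') simp
  then have "\<exists>M. \<forall>x\<in>{a..b}. \<bar>g' x\<bar> \<le> M"
    unfolding bounded_iff by auto
  then obtain M where M: "\<And>x. x \<in> {a..b} \<Longrightarrow> \<bar>g' x\<bar> \<le> M"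
    by blast
  have prod: "(\<lambda>x. m x * f x) integrable_on {a..b}"
    if m: "\<And>x y. \<lbrakk>a \<le> x; x \<le> y; y \<le> b\<rbrakk> \<Longrightarrow> m x \<le> m y" for m :: "real \<Rightarrow> real"
    using second_mean_value_theorem_full[of f a b m, OF f True m]
    by (metis has_integral_integrable)
  have "(\<lambda>x. (g x + M * x) * f x) integrable_on {a..b}"
  proof (rule prod)
    fix x y assume xy: "a \<le> x" "x \<le> y" "y \<le> b"
    show "g x + M * x \<le> g y + M * y"
    proof (rule DERIV_nonneg_imp_nondecreasing[OF xy(2)])
      fix t assume "x \<le> t" "t \<le> y"
      then have t: "t \<in> {a..b}" using xy by auto
      have "((\<lambda>x. g x + M * x) has_real_derivative g' t + M) (at t)"
        using g[OF t] by (auto intro!: derivative_eq_intros)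
      moreover have "g' t + M \<ge> 0" using M[OF t] by linarith
      ultimately show "\<exists>y. ((\<lambda>x. g x + M * x) has_real_derivative y) (at t) \<and> 0 \<le> y" by blast
    qed
  qed
  moreover have "(\<lambda>x. (M * x) * f x) integrable_on {a..b}"
  proof (rule prod)
    fix x y assume xy: "a \<le> x" "x \<le> y" "y \<le> b"
    then have "M \<ge> 0" using M[of x] by fastforce
    then show "M * x \<le> M * y" using xy by (intro mult_left_mono)
  qed
  ultimately have "(\<lambda>x. (g x + M * x) * f x - (M * x) * f x) integrable_on {a..b}"
    by (rule integrable_diff)
  then show ?thesis by (simp add: algebra_simps)
qed (simp add: integrable_on_empty)

lemma zero_outside_func_support: "x \<notin> func_support \<phi> \<Longrightarrow> \<phi> x = 0"
  unfolding func_support_def using closure_subset[of "{x. \<phi> x \<noteq> 0}"] by blast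

lemma func_support_subset:
  assumes "closed K" and "\<And>x. x \<notin> K \<Longrightarrow> \<phi> x = 0"
  shows "func_support \<phi> \<subseteq> K"
  unfolding func_support_def using assms by (intro closure_minimal) auto

lemma deriv_zero_if_locally_constant:
  assumes "open S" "x \<in> S" "\<And>t. t \<in> S \<Longrightarrow> \<phi> t = c"
  shows "deriv \<phi> x = (0::real)"
proof (rule DERIV_imp_deriv)
  have "((\<lambda>_. c) has_real_derivative 0) (at x)" by simp
  then show "(\<phi> has_real_derivative 0) (at x)"
    by (rule has_field_derivative_transform_within_open[OF _ assms(1,2)]) (simp add: assms(3))
qed

lemma test_functionI:
  assumes "infinitely_differentiable \<phi>" and K: "compact K" "K \<subseteq> I"
    and zero: "\<And>x. x \<notin> K \<Longrightarrow> \<phi> x = 0"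
  shows "\<phi> \<in> test_functions I"
proof -
  have sub: "func_support \<phi> \<subseteq> K"
    by (intro func_support_subset compact_imp_closed K(1) zero)
  moreover have "closed (func_support \<phi>)" by (simp add: func_support_def)
  ultimately have "compact (func_support \<phi>)"
    using compact_Int_closed[OF K(1)] by (metis Int_absorb1)
  with sub K(2) assms(1) show ?thesis by (auto simp: test_functions_def)
qed

lemma deriv_test_function:
  assumes "\<phi> \<in> test_functions I"
  shows "deriv \<phi> \<in> test_functions I"
proof -
  have c: "compact (func_support \<phi>)" and s: "func_support \<phi> \<subseteq> I" and d: "infinitely_differentiable \<phi>"
    using assms by (auto simp: test_functions_def)
  show ?thesis
  proof (rule test_functionI[OF infinitely_differentiable_deriv[OF d] c s])
    fix x assume "x \<notin> func_support \<phi>"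
    then show "deriv \<phi> x = 0"
      using compact_imp_closed[OF c] zero_outside_func_support
      by (intro deriv_zero_if_locally_constant[of "- func_support \<phi>" x \<phi> 0]) auto
  qed
qed

lemma interval_subset_if_endpoints:
  fixes I :: "real set"
  assumes "is_interval I" "a \<in> I" "b \<in> I"
  shows "{a..b} \<subseteq> I"
  using mem_is_interval_1_I[OF assms] by (auto intro!: subsetI)

lemma compact_subset_segment:
  fixes I :: "real set"
  assumes "is_interval I" "I \<noteq> {}" "compact K" "K \<subseteq> I"
  obtains a b where "K \<subseteq> {a..b}" "{a..b} \<subseteq> I"
proof (cases "K = {}")
  case True
  \<comment> \<open>The segment from 1 to 0 is empty.\<close>
  then show ?thesis using that[of 1 0] by simp
next
  case False
  obtain a where a: "a \<in> K" "\<forall>t\<in>K. a \<le> t"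
    using compact_attains_inf[OF assms(3) False] by blast
  obtain b where b: "b \<in> K" "\<forall>t\<in>K. t \<le> b"
    using compact_attains_sup[OF assms(3) False] by blast
  have "{a..b} \<subseteq> I"
    using a(1) b(1) assms(4) by (intro interval_subset_if_endpoints assms(1)) auto
  then show ?thesis using a b by (intro that[of a b]) auto
qed

lemma test_product_integrable:
  assumes I: "is_interval I" "I \<noteq> {}" and H: "locally_HK_integrable I H"
    and \<psi>: "\<psi> \<in> test_functions I"
  shows "(\<lambda>t. H t * \<psi> t) integrable_on I"
proof -
  have d: "infinitely_differentiable \<psi>" using \<psi> by (simp add: test_functions_def)
  obtain a b where ab: "func_support \<psi> \<subseteq> {a..b}" "{a..b} \<subseteq> I"
    using compact_subset_segment[OF I, of "func_support \<psi>"] \<psi>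
    by (auto simp: test_functions_def)
  have "(\<lambda>t. H t * \<psi> t) integrable_on {a..b}"
  proof (rule integrable_mult_C1)
    show "H integrable_on {a..b}"
      using H ab(2) by (auto simp: locally_HK_integrable_def)
    show "(\<psi> has_real_derivative deriv \<psi> x) (at x)" for x
      by (rule infinitely_differentiable_has_deriv[OF d])
    show "continuous_on {a..b} (deriv \<psi>)"
      using infinitely_differentiable_has_deriv[OF infinitely_differentiable_deriv[OF d]]
      by (intro continuous_at_imp_continuous_on) (auto intro: DERIV_isCont)
  qed
  then show ?thesis
    by (rule integrable_on_superset[OF _ _ ab(2)])
      (metis ab(1) zero_outside_func_support mult_zero_right subsetD)
qed

lemma distr_deriv_distr_of:
  assumes "\<phi> \<in> test_functions I"
  shows "distr_deriv I (distr_of I H) \<phi> = - integral I (\<lambda>t. H t * deriv \<phi> t)"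
  using assms by (simp add: distr_deriv_def distr_of_def deriv_test_function)

section \<open>Uniqueness of left continuous primitives\<close>

lemma deriv_step_zero:
  fixes s :: "real \<Rightarrow> real"
  assumes "\<And>t. t \<le> a \<Longrightarrow> s t = 1" "\<And>t. t \<ge> b \<Longrightarrow> s t = 0" "t \<notin> {a..b}"
  shows "deriv s t = 0"
proof (cases "t < a")
  case True
  then show ?thesis
    by (intro deriv_zero_if_locally_constant[of "{..<a}" t s 1]) (auto simp: assms(1))
next
  case False
  then show ?thesis
    using assms(3) by (intro deriv_zero_if_locally_constant[of "{b<..}" t s 0]) (auto simp: assms(2))
qed

text \<open>The derivative of a decreasing step is \<open>-1\<close> times a probability density on \<open>[a,b]\<close>, so pairing
  \<open>h\<close> with it averages values of \<open>h\<close> that all lie within \<open>e\<close> of \<open>c\<close>.\<close>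

lemma integral_against_step:
  assumes ab: "a < b" "{a..b} \<subseteq> I" and s: "infinitely_differentiable s" "antimono s"
    "\<And>t. t \<le> a \<Longrightarrow> s t = 1" "\<And>t. t \<ge> b \<Longrightarrow> s t = 0"
    and near: "\<And>t. t \<in> {a..b} \<Longrightarrow> \<bar>h t - c\<bar> \<le> e"
    and int: "(\<lambda>t. h t * deriv s t) integrable_on I"
  shows "\<bar>integral I (\<lambda>t. h t * deriv s t) + c\<bar> \<le> e"
proof -
  note D = infinitely_differentiable_has_deriv[OF s(1)]
  have neg: "deriv s t \<le> 0" for t
  proof -
    have "mono_on UNIV (\<lambda>t. - s t)"
      using s(2) by (auto simp: mono_on_def antimono_def)
    moreover have "((\<lambda>t. - s t) has_real_derivative - deriv s t) (at t)"
      using D by (auto intro!: derivative_intros)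
    ultimately have "- deriv s t \<ge> 0"
      by (rule mono_on_imp_deriv_nonneg) simp
    then show ?thesis by simp
  qed
  note out = deriv_step_zero[OF s(3,4)]
  have "(deriv s has_integral (s b - s a)) {a..b}"
    using ab(1) D
    by (intro fundamental_theorem_of_calculus)
      (auto simp: has_real_derivative_iff_has_vector_derivative[symmetric] intro: DERIV_subset)
  then have "(deriv s has_integral - 1) {a..b}"
    using ab(1) s(3)[of a] s(4)[of b] by simp
  then have ds: "(deriv s has_integral - 1) I"
    by (rule has_integral_on_superset[OF _ _ ab(2)]) (rule out)
  have diff: "((\<lambda>t. h t * deriv s t - c * deriv s t) has_integral
      (integral I (\<lambda>t. h t * deriv s t) - c * (- 1))) I"
    by (intro has_integral_diff has_integral_mult_right ds integrable_integral int)
  have maj: "((\<lambda>t. - e * deriv s t) has_integral (- e) * (- 1)) I"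
    by (intro has_integral_mult_right ds)
  have "norm (h t * deriv s t - c * deriv s t) \<le> - e * deriv s t" if "t \<in> I" for t
  proof (cases "t \<in> {a..b}")
    case True
    have "\<bar>h t - c\<bar> * (- deriv s t) \<le> e * (- deriv s t)"
      using near[OF True] neg[of t] by (intro mult_right_mono) auto
    moreover have "\<bar>h t * deriv s t - c * deriv s t\<bar> = \<bar>h t - c\<bar> * (- deriv s t)"
      using neg[of t] by (simp add: left_diff_distrib[symmetric] abs_mult)
    ultimately show ?thesis by simp
  qed (simp add: out)
  then have "norm (integral I (\<lambda>t. h t * deriv s t) - c * (- 1)) \<le> (- e) * (- 1)"
    using integral_norm_bound_integral[OF has_integral_integrable[OF diff] has_integral_integrable[OF maj]]
    by (simp only: integral_unique[OF diff] integral_unique[OF maj])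
  then show ?thesis by simp
qed

text \<open>A direct form of the du Bois-Reymond lemma.  Take two steps that fall from \<open>1\<close> to \<open>0\<close> just to the
  left of \<open>x\<close> and just to the left of \<open>y\<close>.  Their difference has compact support in \<open>I\<close>, so it is a
  test function, and pairing \<open>h\<close> with its derivative gives approximately \<open>h x - h y\<close>,
  up to sign.  Since the steps vary only to the left of the two points, left continuity suffices,
  and the supports stay inside \<open>I\<close> even when one of the points is its maximum.\<close>

lemma left_continuous_eq_if_weak_derivative_zero:
  fixes h :: "real \<Rightarrow> real"
  assumes I: "is_interval I" and h: "locally_HK_integrable I h"
    and weak: "\<And>\<phi>. \<phi> \<in> test_functions I \<Longrightarrow> integral I (\<lambda>t. h t * deriv \<phi> t) = 0"
    and x: "x \<in> I" "\<not> is_min_of x I" "(h \<longlongrightarrow> h x) (at_left x)"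
    and y: "y \<in> I" "\<not> is_min_of y I" "(h \<longlongrightarrow> h y) (at_left y)"
  shows "h x = h y"
proof -
  have step: "\<exists>a<z. \<exists>s. {a..z} \<subseteq> I \<and> (\<forall>n. times_differentiable n s) \<and>
      (\<forall>t\<le>a. s t = 1) \<and> (\<forall>t\<ge>z. s t = 0) \<and> (\<lambda>t. h t * deriv s t) integrable_on I \<and>
      \<bar>integral I (\<lambda>t. h t * deriv s t) + h z\<bar> \<le> e"
    if z: "z \<in> I" "\<not> is_min_of z I" "(h \<longlongrightarrow> h z) (at_left z)" and e: "e > 0" for z e
  proof -
    obtain p where p: "p \<in> I" "p < z"
      using z(1,2) by (auto simp: is_min_of_def not_le)
    have "\<forall>\<^sub>F t in at_left z. dist (h t) (h z) < e"
      using z(3) e by (rule tendstoD)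
    then obtain q where q: "q < z" "\<And>t. q < t \<Longrightarrow> t < z \<Longrightarrow> dist (h t) (h z) < e"
      unfolding eventually_at_left_field by blast
    obtain a where a: "max p q < a" "a < z"
      using dense[of "max p q" z] p(2) q(1) by auto
    have sub: "{a..z} \<subseteq> I"
      using interval_subset_if_endpoints[OF I p(1) z(1)] a by auto
    have near: "\<bar>h t - h z\<bar> \<le> e" if "t \<in> {a..z}" for t
      using q(2)[of t] that a e by (cases "t = z") (auto simp: dist_real_def)
    obtain s where s: "\<And>n. times_differentiable n s" "antimono s"
      "\<And>t. t \<le> a \<Longrightarrow> s t = 1" "\<And>t. t \<ge> z \<Longrightarrow> s t = 0"
      using smooth_step_exists[OF a(2)] by blast
    note d = infinitely_differentiableI[OF s(1)]
    have "deriv s \<in> test_functions I"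
      by (rule test_functionI[OF infinitely_differentiable_deriv[OF d] compact_Icc sub
            deriv_step_zero[OF s(3,4)]])
    then have int: "(\<lambda>t. h t * deriv s t) integrable_on I"
      using test_product_integrable[OF I _ h] z(1) by blast
    show ?thesis
      using integral_against_step[OF a(2) sub d s(2,3,4) near int] a(2) sub s(1,3,4) int by blast
  qed
  have bound: "\<bar>h x - h y\<bar> \<le> 2 * e" if e: "e > 0" for e
  proof -
    obtain a s where a: "a < x" "{a..x} \<subseteq> I" and s: "\<forall>n. times_differentiable n s"
      "\<forall>t\<le>a. s t = 1" "\<forall>t\<ge>x. s t = 0" "(\<lambda>t. h t * deriv s t) integrable_on I"
      "\<bar>integral I (\<lambda>t. h t * deriv s t) + h x\<bar> \<le> e"
      using step[OF x e] by blast
    obtain b r where b: "b < y" "{b..y} \<subseteq> I" and r: "\<forall>n. times_differentiable n r"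
      "\<forall>t\<le>b. r t = 1" "\<forall>t\<ge>y. r t = 0" "(\<lambda>t. h t * deriv r t) integrable_on I"
      "\<bar>integral I (\<lambda>t. h t * deriv r t) + h y\<bar> \<le> e"
      using step[OF y e] by blast
    define \<phi> where "\<phi> = (\<lambda>t. r t - s t)"
    have td: "infinitely_differentiable \<phi>"
      unfolding \<phi>_def
      by (intro infinitely_differentiableI times_differentiable_diff r(1)[rule_format] s(1)[rule_format])
    have "min a b \<in> I" "max x y \<in> I"
      using a b x(1) y(1) by (auto simp: min_def max_def)
    then have "{min a b..max x y} \<subseteq> I"
      by (rule interval_subset_if_endpoints[OF I])
    then have "\<phi> \<in> test_functions I"
      by (rule test_functionI[OF td compact_Icc]) (use s(2,3) r(2,3) in \<open>auto simp: \<phi>_def not_le\<close>)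
    then have "integral I (\<lambda>t. h t * deriv \<phi> t) = 0" by (rule weak)
    moreover have "deriv \<phi> = (\<lambda>t. deriv r t - deriv s t)"
      unfolding \<phi>_def using r(1) s(1)
      by (intro ext DERIV_imp_deriv DERIV_diff infinitely_differentiable_has_deriv infinitely_differentiableI) auto
    ultimately have "integral I (\<lambda>t. h t * deriv r t) - integral I (\<lambda>t. h t * deriv s t) = 0"
      using integral_diff[OF r(4) s(4)] by (simp add: right_diff_distrib)
    then show ?thesis using s(5) r(5) by linarith
  qed
  show ?thesis
  proof (rule ccontr)
    assume "h x \<noteq> h y"
    then have "\<bar>h x - h y\<bar> > 0" by simp
    then show False using bound[of "\<bar>h x - h y\<bar> / 3"] by simp
  qed
qed

section \<open>Left limits\<close>

text \<open>Fix a jump size.  Close to the left of a point with a left limit, \<open>f\<close> is nearly constant, so no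
  jump of that size occurs there.  Hence each large jump has a rational number to its left with no
  other large jump between, and these rationals are distinct.  There are countably many jump sizes
  \<open>1/n\<close> to consider.\<close>

lemma countable_left_discontinuities:
  fixes f :: "real \<Rightarrow> real"
  shows "countable {x. \<exists>L. (f \<longlongrightarrow> L) (at_left x) \<and> L \<noteq> f x}"
proof -
  define J where "J n = {x. \<exists>L. (f \<longlongrightarrow> L) (at_left x) \<and> inverse (real (Suc n)) \<le> \<bar>f x - L\<bar>}" for n
  have "countable (J n)" for n
  proof -
    \<comment> \<open>A third, since a jump at \<open>y\<close> is at most the sum of the distances of \<open>f y\<close> and of the left limit at
      \<open>y\<close> to \<open>L\<close>, each at most \<open>e\<close>.\<close>
    define e where "e = inverse (real (Suc n)) / 3"
    have e: "e > 0" by (simp add: e_def)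
    have "\<exists>q\<in>\<rat>. q < x \<and> (\<forall>y\<in>J n. \<not> (q < y \<and> y < x))" if "x \<in> J n" for x
    proof -
      from that obtain L where "(f \<longlongrightarrow> L) (at_left x)" by (auto simp: J_def)
      then have "\<forall>\<^sub>F y in at_left x. dist (f y) L < e" using e by (rule tendstoD)
      then obtain b where b: "b < x" "\<And>y. b < y \<Longrightarrow> y < x \<Longrightarrow> dist (f y) L < e"
        unfolding eventually_at_left_field by blast
      obtain q where q: "q \<in> \<rat>" "b < q" "q < x"
        using Rats_dense_in_real[OF b(1)] by blast
      have False if y: "y \<in> J n" "q < y" "y < x" for y
      proof -
        obtain M where M: "(f \<longlongrightarrow> M) (at_left y)" "inverse (real (Suc n)) \<le> \<bar>f y - M\<bar>"
          using y(1) by (auto simp: J_def)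
        have "\<forall>\<^sub>F t in at_left y. f t \<in> cball L e"
          using eventually_at_left_real[OF y(2)]
        proof eventually_elim
          case (elim t)
          then show ?case using b(2)[of t] q(2) y(3) by (simp add: dist_commute)
        qed
        then have "M \<in> cball L e"
          by (rule Lim_in_closed_set[OF closed_cball _ _ M(1)]) simp
        moreover have "dist (f y) L < e" using b(2)[of y] q(2) y by simp
        moreover have "3 * e \<le> \<bar>f y - M\<bar>" using M(2) by (simp add: e_def)
        ultimately show False using e by (auto simp: dist_real_def)
      qed
      with q show ?thesis by blast
    qed
    then obtain q where q: "\<And>x. x \<in> J n \<Longrightarrow> q x \<in> \<rat> \<and> q x < x \<and> (\<forall>y\<in>J n. \<not> (q x < y \<and> y < x))"
      by metis
    have "inj_on q (J n)"
    proof (rule linorder_inj_onI')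
      fix x y assume "x \<in> J n" "y \<in> J n" "x < y"
      then show "q x \<noteq> q y" using q by metis
    qed
    moreover have "countable (q ` J n)"
      using q by (intro countable_subset[OF _ countable_rat]) auto
    ultimately show ?thesis
      by (rule countable_image_inj_on[rotated])
  qed
  moreover have "{x. \<exists>L. (f \<longlongrightarrow> L) (at_left x) \<and> L \<noteq> f x} \<subseteq> (\<Union>n. J n)"
  proof
    fix x assume "x \<in> {x. \<exists>L. (f \<longlongrightarrow> L) (at_left x) \<and> L \<noteq> f x}"
    then obtain L where L: "(f \<longlongrightarrow> L) (at_left x)" "\<bar>f x - L\<bar> > 0" by auto
    obtain n where "inverse (real (Suc n)) < \<bar>f x - L\<bar>" using reals_Archimedean[OF L(2)] by blast
    then show "x \<in> (\<Union>n. J n)" using L(1) unfolding J_def by (auto intro!: exI[of _ n] exI[of _ L])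
  qed
  ultimately show ?thesis
    by (meson countable_UN countable_subset uncountable_def UNIV_I countableI_type)
qed

text \<open>Replacing a function by its left limits keeps its limit along a filter, provided that what holds
  eventually along the filter also holds just to the left of points that are eventual along it.
  The lemmas below verify this for the filters that occur.\<close>

lemma tendsto_left_limits:
  fixes H G :: "real \<Rightarrow> real"
  assumes lim: "(H \<longlongrightarrow> L) F"
    and left: "\<forall>\<^sub>F x in F. (H \<longlongrightarrow> G x) (at_left x)"
    and spread: "\<And>P. eventually P F \<Longrightarrow> \<forall>\<^sub>F x in F. eventually P (at_left x)"
  shows "(G \<longlongrightarrow> L) F"
proof (rule tendstoI)
  fix e :: real assume e: "e > 0"
  then have "\<forall>\<^sub>F t in F. H t \<in> cball L (e / 2)"
    using tendstoD[OF lim, of "e / 2"] by (auto elim!: eventually_mono simp: dist_commute)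
  then have "\<forall>\<^sub>F x in F. \<forall>\<^sub>F t in at_left x. H t \<in> cball L (e / 2)" by (rule spread)
  with left show "\<forall>\<^sub>F x in F. dist (G x) L < e"
  proof eventually_elim
    case (elim x)
    then have "G x \<in> cball L (e / 2)"
      by (intro Lim_in_closed_set[OF closed_cball]) auto
    then show ?case using e by (simp add: dist_commute)
  qed
qed

lemma eventually_at_left_spread:
  fixes x :: real
  assumes "eventually P (at_left x)"
  shows "\<forall>\<^sub>F y in at_left x. eventually P (at_left y)"
proof -
  obtain b where b: "b < x" "\<And>y. b < y \<Longrightarrow> y < x \<Longrightarrow> P y"
    using assms unfolding eventually_at_left_field by blast
  have "eventually P (at_left y)" if "y \<in> {b<..<x}" for y
    unfolding eventually_at_left_field using that b by (intro exI[of _ b]) auto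
  with eventually_at_left_real[OF b(1)] show ?thesis by (rule eventually_mono)
qed

lemma eventually_at_right_spread:
  fixes x :: real
  assumes "eventually P (at_right x)"
  shows "\<forall>\<^sub>F y in at_right x. eventually P (at_left y)"
proof -
  obtain b where b: "x < b" "\<And>y. x < y \<Longrightarrow> y < b \<Longrightarrow> P y"
    using assms unfolding eventually_at_right_field by blast
  have "eventually P (at_left y)" if "y \<in> {x<..<b}" for y
    unfolding eventually_at_left_field using that b by (intro exI[of _ x]) auto
  with eventually_at_right_real[OF b(1)] show ?thesis by (rule eventually_mono)
qed

lemma eventually_at_bot_spread:
  assumes "eventually P (at_bot :: real filter)"
  shows "\<forall>\<^sub>F y in at_bot. eventually P (at_left y)"
proof -
  obtain b where b: "\<And>y. y < b \<Longrightarrow> P y"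
    using assms unfolding eventually_at_bot_dense by blast
  have "eventually P (at_left y)" if "y < b" for y
    unfolding eventually_at_left_field using that b by (intro exI[of _ "y - 1"]) auto
  then show ?thesis unfolding eventually_at_bot_dense by blast
qed

lemma at_inf_right_spread:
  "eventually P (at_inf_right I) \<Longrightarrow> \<forall>\<^sub>F y in at_inf_right I. eventually P (at_left y)"
  unfolding at_inf_right_def
  by (auto intro: eventually_at_right_spread eventually_at_bot_spread)

lemma eventually_at_inf_right_interior:
  fixes I :: "real set"
  assumes I: "is_interval I" and uv: "u \<in> I" "v \<in> I" "u < v"
  shows "\<forall>\<^sub>F x in at_inf_right I. x \<in> I \<and> \<not> is_min_of x I"
proof -
  have *: "x \<in> I \<and> \<not> is_min_of x I" if "y \<in> I" "y < x" "x < v" for x y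
    using that uv mem_is_interval_1_I[OF I that(1) uv(2), of x] by (force simp: is_min_of_def)
  show ?thesis
  proof (cases "bdd_below I")
    case True
    have "Inf I < v" using cInf_lower[OF uv(1) True] uv(3) by simp
    moreover have "x \<in> I \<and> \<not> is_min_of x I" if x: "x \<in> {Inf I<..<v}" for x
    proof -
      obtain y where "y \<in> I" "y < x"
        using cInf_lessD[of I x] x uv(1) by auto
      then show ?thesis using * x by simp
    qed
    ultimately show ?thesis
      using True eventually_at_right_real[of "Inf I" v]
      by (auto simp: at_inf_right_def elim: eventually_mono)
  next
    case False
    have "x \<in> I \<and> \<not> is_min_of x I" if "x < v" for x
    proof -
      obtain y where "y \<in> I" "y < x" using False by (force simp: bdd_below_def not_le)
      then show ?thesis using * that by simp
    qed
    then show ?thesis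
      using False by (auto simp: at_inf_right_def eventually_at_bot_dense intro!: exI[of _ v])
  qed
qed

lemma eventually_at_left_interior:
  fixes I :: "real set"
  assumes I: "is_interval I" and x: "x \<in> I" "\<not> is_min_of x I"
  shows "\<forall>\<^sub>F y in at_left x. y \<in> I \<and> \<not> is_min_of y I"
proof -
  obtain p where p: "p \<in> I" "p < x" using x by (auto simp: is_min_of_def not_le)
  have "y \<in> I \<and> \<not> is_min_of y I" if "y \<in> {p<..<x}" for y
    using that mem_is_interval_1_I[OF I p(1) x(1), of y] p by (force simp: is_min_of_def)
  with eventually_at_left_real[OF p(2)] show ?thesis by (rule eventually_mono)
qed

lemma at_inf_right_min:
  assumes "is_min_of x I"
  shows "at_inf_right I = at_right x"
proof -
  have "Inf I = x" using assms by (intro cInf_eq_minimum) (auto simp: is_min_of_def)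
  moreover have "bdd_below I" using assms by (auto simp: is_min_of_def)
  ultimately show ?thesis by (simp add: at_inf_right_def)
qed

lemma distr_of_cong_negligible:
  assumes "negligible N" "\<And>t. t \<in> I - N \<Longrightarrow> G t = H t"
  shows "distr_of I G = distr_of I H"
  unfolding distr_of_def
  by (intro ext if_cong refl integral_spike[OF assms(1)]) (simp add: assms(2))

text \<open>Left limits replace the values of \<open>H\<close>, and the right limit replaces the value at a minimum.
  Only countably many values change, so the pairing with test functions is the same.\<close>

lemma primitive_in_D_lc_exists:
  fixes I :: "real set"
  assumes I: "is_interval I" and uv: "u \<in> I" "v \<in> I" "u < v" and f: "primitive_of I H f"
  obtains G where "G \<in> D_lc I" "primitive_of I G f"
proof -
  have H: "left_regulated I H" "locally_HK_integrable I H"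
    using f by (auto simp: primitive_of_def D_lr_def)
  obtain L where L: "(H \<longlongrightarrow> L) (at_inf_right I)"
    using f by (auto simp: primitive_of_def D_lr_def)
  define G where "G x = (if is_min_of x I then L else Lim (at_left x) H)" for x
  have left: "(H \<longlongrightarrow> G x) (at_left x)" if x: "x \<in> I" "\<not> is_min_of x I" for x
  proof -
    obtain M where M: "(H \<longlongrightarrow> M) (at_left x)"
      using H(1) x by (auto simp: left_regulated_def)
    then have "Lim (at_left x) H = M" by (intro tendsto_Lim) simp
    with M x(2) show ?thesis by (simp add: G_def)
  qed
  have Gleft: "(G \<longlongrightarrow> G x) (at_left x)" if x: "x \<in> I" "\<not> is_min_of x I" for x
  proof (rule tendsto_left_limits[OF left[OF x]])
    show "\<forall>\<^sub>F y in at_left x. (H \<longlongrightarrow> G y) (at_left y)"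
      using eventually_at_left_interior[OF I x] by eventually_elim (simp add: left)
  qed (rule eventually_at_left_spread)
  have Ginf: "(G \<longlongrightarrow> L) (at_inf_right I)"
  proof (rule tendsto_left_limits[OF L])
    show "\<forall>\<^sub>F y in at_inf_right I. (H \<longlongrightarrow> G y) (at_left y)"
      using eventually_at_inf_right_interior[OF I uv] by eventually_elim (simp add: left)
  qed (rule at_inf_right_spread)
  define N where "N = {x. \<exists>L. (H \<longlongrightarrow> L) (at_left x) \<and> L \<noteq> H x} \<union> {x. is_min_of x I}"
  have "{x. is_min_of x I} \<subseteq> {Inf I}"
    by (auto simp: is_min_of_def intro!: cInf_eq_minimum[symmetric])
  then have "countable {x. is_min_of x I}"
    by (rule countable_subset) simp
  then have "countable N"
    unfolding N_def using countable_left_discontinuities[of H] by simp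
  then have N: "negligible N"
    using countable_imp_null_set_lborel[of N] null_sets_completionI[of N lborel]
    by (simp add: negligible_iff_null_sets)
  have eq: "G t = H t" if "t \<in> I - N" for t
    using left[of t] that by (auto simp: N_def)
  have "locally_HK_integrable I G"
    using H(2) eq unfolding locally_HK_integrable_def
    by (blast intro: integrable_spike[OF _ N])
  then have lr: "G \<in> D_lr I"
    using Gleft Ginf by (auto simp: D_lr_def left_regulated_def)
  have lc: "G \<in> D_lc I"
    using lr Gleft Ginf at_inf_right_min by (auto simp: D_lc_def G_def)
  have "primitive_of I G f"
    using f lr distr_of_cong_negligible[of N I G H, OF N eq] by (simp add: primitive_of_def)
  with lc that show thesis by blast
qed

section \<open>Linear combinations\<close>

lemma D_lr_lincomb:
  assumes "F \<in> D_lr I" "G \<in> D_lr I"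
  shows "(\<lambda>t. c * F t + d * G t) \<in> D_lr I"
proof -
  have "left_regulated I (\<lambda>t. c * F t + d * G t)"
    unfolding left_regulated_def
  proof (intro ballI impI)
    fix x assume "x \<in> I" "\<not> is_min_of x I"
    then obtain L M where "(F \<longlongrightarrow> L) (at_left x)" "(G \<longlongrightarrow> M) (at_left x)"
      using assms unfolding D_lr_def left_regulated_def by blast
    then have "((\<lambda>t. c * F t + d * G t) \<longlongrightarrow> c * L + d * M) (at_left x)"
      by (intro tendsto_intros)
    then show "\<exists>L. ((\<lambda>t. c * F t + d * G t) \<longlongrightarrow> L) (at_left x)" ..
  qed
  moreover have "locally_HK_integrable I (\<lambda>t. c * F t + d * G t)"
    using assms unfolding D_lr_def locally_HK_integrable_def
    by (auto intro!: integrable_add integrable_on_mult_right)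
  moreover obtain L M where "(F \<longlongrightarrow> L) (at_inf_right I)" "(G \<longlongrightarrow> M) (at_inf_right I)"
    using assms unfolding D_lr_def by blast
  then have "((\<lambda>t. c * F t + d * G t) \<longlongrightarrow> c * L + d * M) (at_inf_right I)"
    by (intro tendsto_intros)
  ultimately show ?thesis by (auto simp: D_lr_def)
qed

lemma D_lc_lincomb:
  assumes "F \<in> D_lc I" "G \<in> D_lc I"
  shows "(\<lambda>t. c * F t + d * G t) \<in> D_lc I"
  using assms D_lr_lincomb[of F I G c d] unfolding D_lc_def
  by (auto intro!: tendsto_intros)

lemma primitive_of_lincomb:
  assumes I: "is_interval I" "I \<noteq> {}" and F: "primitive_of I F f" and G: "primitive_of I G g"
  shows "primitive_of I (\<lambda>t. c * F t + d * G t) (\<lambda>\<phi>. c * f \<phi> + d * g \<phi>)"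
proof -
  have lr: "F \<in> D_lr I" "G \<in> D_lr I" using F G by (auto simp: primitive_of_def)
  have "c * distr_deriv I (distr_of I F) \<phi> + d * distr_deriv I (distr_of I G) \<phi>
      = distr_deriv I (distr_of I (\<lambda>t. c * F t + d * G t)) \<phi>" for \<phi>
  proof (cases "\<phi> \<in> test_functions I")
    case True
    have "(\<lambda>t. F t * deriv \<phi> t) integrable_on I" "(\<lambda>t. G t * deriv \<phi> t) integrable_on I"
      using lr by (auto simp: D_lr_def intro!: test_product_integrable I deriv_test_function True)
    then have "((\<lambda>t. c * (F t * deriv \<phi> t) + d * (G t * deriv \<phi> t)) has_integral
        c * integral I (\<lambda>t. F t * deriv \<phi> t) + d * integral I (\<lambda>t. G t * deriv \<phi> t)) I"
      by (intro has_integral_add has_integral_mult_right integrable_integral)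
    then have "integral I (\<lambda>t. (c * F t + d * G t) * deriv \<phi> t)
        = c * integral I (\<lambda>t. F t * deriv \<phi> t) + d * integral I (\<lambda>t. G t * deriv \<phi> t)"
      by (intro integral_unique) (simp add: algebra_simps)
    then show ?thesis using True by (simp add: distr_deriv_distr_of)
  qed (simp add: distr_deriv_def)
  then show ?thesis
    using F G D_lr_lincomb[OF lr] by (auto simp: primitive_of_def fun_eq_iff)
qed

lemma distributions_lincomb:
  assumes "f \<in> distributions I" "g \<in> distributions I"
  shows "(\<lambda>\<phi>. c * f \<phi> + d * g \<phi>) \<in> distributions I"
  unfolding distributions_def
proof (intro CollectI conjI allI impI ballI)
  fix \<phi> assume "\<phi> \<notin> test_functions I"
  then show "c * f \<phi> + d * g \<phi> = 0" using assms by (simp add: distributions_def)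
next
  fix \<phi> \<psi> a b assume "\<phi> \<in> test_functions I" "\<psi> \<in> test_functions I"
  then have "f (\<lambda>x. a * \<phi> x + b * \<psi> x) = a * f \<phi> + b * f \<psi>"
    "g (\<lambda>x. a * \<phi> x + b * \<psi> x) = a * g \<phi> + b * g \<psi>"
    using assms by (auto simp: distributions_def)
  then show "c * f (\<lambda>x. a * \<phi> x + b * \<psi> x) + d * g (\<lambda>x. a * \<phi> x + b * \<psi> x)
      = a * (c * f \<phi> + d * g \<phi>) + b * (c * f \<psi> + d * g \<psi>)"
    by (simp add: algebra_simps)
next
  fix \<phi>s \<phi>
  assume "\<forall>n. \<phi>s n \<in> test_functions I" "\<phi> \<in> test_functions I" "test_converges I \<phi>s \<phi>"
  then have "(\<lambda>n. f (\<phi>s n)) \<longlonglongrightarrow> f \<phi>" "(\<lambda>n. g (\<phi>s n)) \<longlonglongrightarrow> g \<phi>"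
    using assms unfolding distributions_def by blast+
  then show "(\<lambda>n. c * f (\<phi>s n) + d * g (\<phi>s n)) \<longlonglongrightarrow> c * f \<phi> + d * g \<phi>"
    by (intro tendsto_intros)
qed

section \<open>The primitive integral\<close>

text \<open>The difference of the primitives has distributional derivative zero, hence takes one value
  away from the minimum; right continuity carries that value to a minimum in \<open>I\<close>.\<close>

lemma primitive_increment_unique:
  fixes I :: "real set"
  assumes I: "is_interval I" and uv: "u \<in> I" "v \<in> I" "u < v"
    and F: "F \<in> D_lc I" "primitive_of I F f" and G: "G \<in> D_lc I" "primitive_of I G f"
    and ab: "a \<in> I" "b \<in> I"
  shows "F b - F a = G b - G a"
proof -
  have ne: "I \<noteq> {}" using uv by auto
  define h where "h = (\<lambda>t. 1 * F t + (-1) * G t)"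
  have h: "h \<in> D_lc I" unfolding h_def by (rule D_lc_lincomb[OF F(1) G(1)])
  have "primitive_of I h (\<lambda>\<phi>. 1 * f \<phi> + (-1) * f \<phi>)"
    unfolding h_def by (rule primitive_of_lincomb[OF I ne F(2) G(2)])
  then have "distr_deriv I (distr_of I h) \<phi> = 0" for \<phi>
    by (simp add: primitive_of_def fun_eq_iff)
  then have weak: "integral I (\<lambda>t. h t * deriv \<phi> t) = 0" if "\<phi> \<in> test_functions I" for \<phi>
    using distr_deriv_distr_of[OF that, of h] by simp
  have HK: "locally_HK_integrable I h" and
    left: "\<And>x. x \<in> I \<Longrightarrow> \<not> is_min_of x I \<Longrightarrow> (h \<longlongrightarrow> h x) (at_left x)" and
    right: "\<And>x. is_min_of x I \<Longrightarrow> (h \<longlongrightarrow> h x) (at_right x)"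
    using h by (auto simp: D_lc_def D_lr_def)
  have v: "\<not> is_min_of v I" using uv by (force simp: is_min_of_def)
  have const: "h x = h v" if "x \<in> I" "\<not> is_min_of x I" for x
    using left_continuous_eq_if_weak_derivative_zero[OF I HK weak that left[OF that] uv(2) v left[OF uv(2) v]] .
  have "h x = h v" if x: "x \<in> I" for x
  proof (cases "is_min_of x I")
    case True
    have "\<forall>\<^sub>F t in at_right x. h v = h t"
      using eventually_at_inf_right_interior[OF I uv] unfolding at_inf_right_min[OF True]
      by eventually_elim (simp add: const)
    then have "(h \<longlongrightarrow> h v) (at_right x)"
      by (rule Lim_transform_eventually[OF tendsto_const])
    then show ?thesis
      using tendsto_unique[OF _ right[OF True]] by simp
  qed (use const x in blast)
  from this[OF ab(1)] this[OF ab(2)] show ?thesis by (simp add: h_def)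
qed

lemma LD_integral_eq:
  fixes I :: "real set"
  assumes I: "is_interval I" "u \<in> I" "v \<in> I" "u < v"
    and F: "F \<in> D_lc I" "primitive_of I F f" and ab: "a \<in> I" "b \<in> I"
  shows "LD_integral I a b f = F b - F a"
proof -
  define G where "G = (SOME G. G \<in> D_lc I \<and> primitive_of I G f)"
  have G: "G \<in> D_lc I \<and> primitive_of I G f"
    unfolding G_def by (rule someI[of _ F]) (use F in blast)
  then have "G b - G a = F b - F a"
    using primitive_increment_unique[OF I _ _ F ab] by blast
  then show ?thesis by (simp add: LD_integral_def G_def Let_def)
qed

theorem theorem3p2:
  fixes I :: "real set"
  assumes "is_interval I" and "\<exists>x\<in>I. \<exists>y\<in>I. x < y"
  shows "(\<forall>f\<in>A_D I. \<forall>F\<in>D_lc I. \<forall>G\<in>D_lc I. primitive_of I F f \<longrightarrow> primitive_of I G f \<longrightarrow>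
            (\<forall>a\<in>I. \<forall>b\<in>I. F b - F a = G b - G a \<and> LD_integral I a b f = F b - F a)) \<and>
         (\<forall>f\<in>A_D I. \<forall>a\<in>I. \<forall>b\<in>I. \<forall>c\<in>I. a \<le> c \<and> c \<le> b \<longrightarrow>
            LD_integral I a c f + LD_integral I c b f = LD_integral I a b f) \<and>
         (\<forall>f1\<in>A_D I. \<forall>f2\<in>A_D I. \<forall>a1 a2 :: real.
            (\<lambda>\<phi>. a1 * f1 \<phi> + a2 * f2 \<phi>) \<in> A_D I \<and>
            (\<forall>a\<in>I. \<forall>b\<in>I. LD_integral I a b (\<lambda>\<phi>. a1 * f1 \<phi> + a2 * f2 \<phi>)
                            = a1 * LD_integral I a b f1 + a2 * LD_integral I a b f2)) \<and>
         (\<forall>f\<in>A_D I. \<forall>a\<in>I. \<forall>b\<in>I. LD_integral I b a f = - LD_integral I a b f)"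
proof -
  obtain u v where uv: "u \<in> I" "v \<in> I" "u < v" using assms(2) by blast
  note I = assms(1) uv
  have ne: "I \<noteq> {}" using uv by auto
  have prim: "\<exists>F. F \<in> D_lc I \<and> primitive_of I F f" if "f \<in> A_D I" for f
    using that primitive_in_D_lc_exists[OF I] unfolding A_D_def by blast
  have unique: "F b - F a = G b - G a \<and> LD_integral I a b f = F b - F a"
    if "F \<in> D_lc I" "G \<in> D_lc I" "primitive_of I F f" "primitive_of I G f" "a \<in> I" "b \<in> I"
    for f F G a b
    using primitive_increment_unique[OF I that(1,3,2,4-)] LD_integral_eq[OF I that(1,3,5,6)] by blast
  have lin: "(\<lambda>\<phi>. a1 * f1 \<phi> + a2 * f2 \<phi>) \<in> A_D I \<and>
      (\<forall>a\<in>I. \<forall>b\<in>I. LD_integral I a b (\<lambda>\<phi>. a1 * f1 \<phi> + a2 * f2 \<phi>)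
                      = a1 * LD_integral I a b f1 + a2 * LD_integral I a b f2)"
    if f: "f1 \<in> A_D I" "f2 \<in> A_D I" for f1 f2 a1 a2
  proof -
    obtain F1 F2 where F1: "F1 \<in> D_lc I" "primitive_of I F1 f1"
      and F2: "F2 \<in> D_lc I" "primitive_of I F2 f2"
      using prim f by meson
    note F = D_lc_lincomb[OF F1(1) F2(1), of a1 a2] primitive_of_lincomb[OF assms(1) ne F1(2) F2(2), of a1 a2]
    have "(\<lambda>\<phi>. a1 * f1 \<phi> + a2 * f2 \<phi>) \<in> A_D I"
      using f F(2) distributions_lincomb[of f1 I f2 a1 a2] unfolding A_D_def by blast
    moreover have "LD_integral I a b (\<lambda>\<phi>. a1 * f1 \<phi> + a2 * f2 \<phi>)
        = a1 * LD_integral I a b f1 + a2 * LD_integral I a b f2" if "a \<in> I" "b \<in> I" for a b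
      using LD_integral_eq[OF I F that] LD_integral_eq[OF I F1 that] LD_integral_eq[OF I F2 that]
      by (simp only:) (simp add: algebra_simps)
    ultimately show ?thesis by blast
  qed
  have add: "LD_integral I a c f + LD_integral I c b f = LD_integral I a b f"
    and rev: "LD_integral I b a f = - LD_integral I a b f" for f a b c
    by (simp_all add: LD_integral_def Let_def)
  show ?thesis
    using unique lin add rev by blast
qed

end
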